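(* Let $\mathbb{F}$ be a field of odd characteristic $p$. Let $m\geq 2$ and $n$ be positive integers such that $mn-1\geq p\geq n$. Suppose $A\in \mathbb{M}_n(\mathbb{F})$ is a nonderogatory matrix such that $\mathrm{Tr}(A)=t\cdot 1$ for some $t\in\{0,\dots,p-1\}$. Then there exist idempotent matrices $E_1,\dots,E_m\in\mathbb{M}_n(\mathbb{F})$ and a nilpotent matrix $V\in\mathbb{M}_n(\mathbb{F})$ such that $A=E_1+\dots+E_m+V$ and $V^{\left[\frac{p-2}{m}\right]+2}=0$.
   Context: $\mathbb{M}_n(\mathbb{F})$ is the ring of $n\times n$ matrices over $\mathbb{F}$. The characteristic $p$ is positive (an odd prime). A square matrix is nonderogatory if its characteristic and minimal polynomials coincide. For an integer $t$, $t\cdot 1$ denotes the corresponding integer multiple of the unity of $\mathbb{F}$. $[x]$ denotes the integer part (floor) of the real number $x$. A matrix $E$ is idempotent if $E^2=E$. *)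

theory Defs
  imports "Jordan_Normal_Form.Char_Poly"
begin

definition mat_trace :: "'a :: comm_monoid_add mat \<Rightarrow> 'a" where
  "mat_trace A = (\<Sum>i<dim_row A. A $$ (i, i))"

definition idempotent_mat :: "'a :: semiring_1 mat \<Rightarrow> bool" where
  "idempotent_mat E \<longleftrightarrow> square_mat E \<and> E * E = E"

definition nilpotent_mat :: "'a :: semiring_1 mat \<Rightarrow> bool" where
  "nilpotent_mat V \<longleftrightarrow> square_mat V \<and> (\<exists>k. V ^\<^sub>m k = 0\<^sub>m (dim_row V) (dim_row V))"

text \<open>Matrices of varying size form no \<^class>\<open>comm_monoid_add\<close>, so finite sums of \<open>n \<times> n\<close> matrices
  are taken in the ring \<^const>\<open>ring_mat\<close>.\<close>

definition poly_mat_eval :: "'a :: comm_ring_1 poly \<Rightarrow> 'a mat \<Rightarrow> 'a mat" where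
  "poly_mat_eval q A =
     (\<Oplus>\<^bsub>ring_mat TYPE('a) (dim_row A) ()\<^esub>k\<in>{..degree q}. coeff q k \<cdot>\<^sub>m (A ^\<^sub>m k))"

definition is_min_poly :: "'a :: field mat \<Rightarrow> 'a poly \<Rightarrow> bool" where
  "is_min_poly A q \<longleftrightarrow>
     monic q \<and> poly_mat_eval q A = 0\<^sub>m (dim_row A) (dim_row A) \<and>
     (\<forall>r. monic r \<and> poly_mat_eval r A = 0\<^sub>m (dim_row A) (dim_row A) \<longrightarrow> degree q \<le> degree r)"

definition nonderogatory :: "'a :: field mat \<Rightarrow> bool" where
  "nonderogatory A \<longleftrightarrow> square_mat A \<and> is_min_poly A (char_poly A)"

lemma finsum_mat_index:
  fixes f :: "'b \<Rightarrow> 'a :: comm_ring_1 mat"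
  assumes "finite I" "\<And>k. k \<in> I \<Longrightarrow> f k \<in> carrier_mat n n" "i < n" "j < n"
  shows "(\<Oplus>\<^bsub>ring_mat TYPE('a) n ()\<^esub>k\<in>I. f k) \<in> carrier_mat n n"
    and "(\<Oplus>\<^bsub>ring_mat TYPE('a) n ()\<^esub>k\<in>I. f k) $$ (i, j) = (\<Sum>k\<in>I. f k $$ (i, j))"
proof -
  interpret R: ring "ring_mat TYPE('a) n ()" by (rule ring_mat)
  have "(\<Oplus>\<^bsub>ring_mat TYPE('a) n ()\<^esub>k\<in>I. f k) \<in> carrier_mat n n \<and>
    (\<Oplus>\<^bsub>ring_mat TYPE('a) n ()\<^esub>k\<in>I. f k) $$ (i, j) = (\<Sum>k\<in>I. f k $$ (i, j))"
    using assms(1,2)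
  proof (induction I rule: finite_induct)
    case empty
    then show ?case using assms by (simp add: ring_mat_simps)
  next
    case (insert x F)
    have "(\<Oplus>\<^bsub>ring_mat TYPE('a) n ()\<^esub>k\<in>insert x F. f k)
        = f x + (\<Oplus>\<^bsub>ring_mat TYPE('a) n ()\<^esub>k\<in>F. f k)"
      using insert by (subst R.finsum_insert) (auto simp: ring_mat_simps)
    then show ?case using insert assms(3,4) by auto
  qed
  then show "(\<Oplus>\<^bsub>ring_mat TYPE('a) n ()\<^esub>k\<in>I. f k) \<in> carrier_mat n n"
    and "(\<Oplus>\<^bsub>ring_mat TYPE('a) n ()\<^esub>k\<in>I. f k) $$ (i, j) = (\<Sum>k\<in>I. f k $$ (i, j))"
    by auto
qed

lemma poly_mat_eval_carrier:
  fixes A :: "'a :: comm_ring_1 mat"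
  assumes "A \<in> carrier_mat n n"
  shows "poly_mat_eval q A \<in> carrier_mat n n"
proof -
  interpret R: ring "ring_mat TYPE('a) n ()" by (rule ring_mat)
  have "(\<Oplus>\<^bsub>ring_mat TYPE('a) n ()\<^esub>k\<in>{..degree q}. coeff q k \<cdot>\<^sub>m (A ^\<^sub>m k))
      \<in> carrier (ring_mat TYPE('a) n ())"
    using assms by (intro R.finsum_closed) (auto simp: ring_mat_simps)
  then show ?thesis using assms by (auto simp: poly_mat_eval_def ring_mat_simps)
qed

lemma poly_mat_eval_index:
  assumes A: "A \<in> carrier_mat n n" and "i < n" "j < n" and d: "degree q \<le> d"
  shows "poly_mat_eval q A $$ (i, j) = (\<Sum>k\<le>d. coeff q k * (A ^\<^sub>m k) $$ (i, j))"
proof -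
  have "poly_mat_eval q A $$ (i, j) = (\<Sum>k\<le>degree q. (coeff q k \<cdot>\<^sub>m (A ^\<^sub>m k)) $$ (i, j))"
    unfolding poly_mat_eval_def using assms
    by (simp add: finsum_mat_index(2))
  also have "\<dots> = (\<Sum>k\<le>degree q. coeff q k * (A ^\<^sub>m k) $$ (i, j))"
    using assms by (intro sum.cong) auto
  also have "\<dots> = (\<Sum>k\<le>d. coeff q k * (A ^\<^sub>m k) $$ (i, j))"
    using d by (intro sum.mono_neutral_left) (auto simp: coeff_eq_0)
  finally show ?thesis .
qed

lemma is_min_poly_unique:
  assumes A: "square_mat A" and q: "is_min_poly A q" and r: "is_min_poly A r"
  shows "q = r"
proof (rule ccontr)
  assume "q \<noteq> r"
  define n where "n = dim_row A"
  have An: "A \<in> carrier_mat n n" using A by (auto simp: n_def)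
  have deg: "degree q = degree r"
    using q r by (auto simp: is_min_poly_def intro: antisym)
  define s where "s = q - r"
  define u where "u = Polynomial.smult (inverse (lead_coeff s)) s"
  have s0: "s \<noteq> 0" using \<open>q \<noteq> r\<close> by (simp add: s_def)
  have "coeff s (degree q) = 0" using q r deg by (simp add: s_def is_min_poly_def)
  moreover have "degree s \<le> degree q" using deg by (simp add: s_def degree_diff_le)
  ultimately have dlt: "degree s < degree q"
    using s0 by (metis leading_coeff_0_iff le_neq_implies_less)
  have u: "monic u" "degree u = degree s" using s0 by (auto simp: u_def)
  have "poly_mat_eval u A = 0\<^sub>m n n"
  proof (rule eq_matI)
    fix i j assume "i < dim_row (0\<^sub>m n n :: 'a mat)" "j < dim_col (0\<^sub>m n n :: 'a mat)"
    then have ij: "i < n" "j < n" by auto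
    let ?e = "\<lambda>p. \<Sum>k\<le>degree q. coeff p k * (A ^\<^sub>m k) $$ (i, j)"
    have "poly_mat_eval u A $$ (i, j) = ?e u"
      using poly_mat_eval_index[OF An ij, of u "degree q"] u dlt by simp
    also have "\<dots> = inverse (lead_coeff s) * (?e q - ?e r)"
      by (simp add: u_def s_def sum_distrib_left sum_subtractf algebra_simps)
    also have "?e q = poly_mat_eval q A $$ (i, j)"
      using poly_mat_eval_index[OF An ij, of q "degree q"] by simp
    also have "?e r = poly_mat_eval r A $$ (i, j)"
      using poly_mat_eval_index[OF An ij, of r "degree q"] deg by simp
    also have "poly_mat_eval q A = 0\<^sub>m n n" using q by (simp add: is_min_poly_def n_def)
    also have "poly_mat_eval r A = 0\<^sub>m n n" using r by (simp add: is_min_poly_def n_def)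
    finally show "poly_mat_eval u A $$ (i, j) = 0\<^sub>m n n $$ (i, j)" using ij by simp
  qed (use poly_mat_eval_carrier[OF An, of u] in auto)
  then have "degree q \<le> degree u" using q u(1) unfolding is_min_poly_def n_def by blast
  then show False using u dlt by simp
qed

end

theory Submission
  imports Defs
begin

text \<open>A nonderogatory \<open>A\<close> has a cyclic vector \<open>v\<close>. For any prescribed \<open>d\<close>, the basis \<open>b\<^sub>0 = v\<close>,
  \<open>b\<^sub>j\<^sub>+\<^sub>1 = (A - d\<^sub>j) b\<^sub>j\<close> turns \<open>A\<close> into a matrix \<open>H\<close> with diagonal \<open>d\<^sub>0, \<dots>, d\<^sub>n\<^sub>-\<^sub>2\<close>, ones on the
  subdiagonal and zeros elsewhere, except for an uncontrolled last column whose diagonal entry is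
  fixed by the trace. Take \<open>d\<close> to be the sum of the diagonals of \<open>m\<close> idempotents of total rank
  \<open>T \<in> {t, t + p}\<close>. The first idempotent, of rank \<open>1\<close> or \<open>n - 1\<close>, absorbs the last column; the second
  absorbs every \<open>k\<close>-th subdiagonal one counted from the bottom, where \<open>k = (p - 2) div m + 2\<close>; the
  others are diagonal. What remains of the subdiagonal splits into nilpotent Jordan blocks of size at
  most \<open>k\<close>. If \<open>q\<close> ones are cut out, every \<open>T\<close> with \<open>q + 1 \<le> T \<le> m n - 1 - q\<close> is possible, and
  \<open>2 q + 1 \<le> m n - p\<close> guarantees that \<open>t\<close> or \<open>t + p\<close> lies in this range.\<close>

subsection \<open>Cyclic vectors\<close>

text \<open>This supplies irreducible factors: a nonconstant divisor of least degree cannot split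
  further. The condition on degrees is the form of irreducibility that the Bezout argument
  uses.\<close>

lemma min_degree_divisor:
  fixes h :: "'a :: field poly"
  assumes "degree h > 0"
  obtains \<pi> where "\<pi> dvd h" "degree \<pi> > 0" "\<And>g. g dvd \<pi> \<Longrightarrow> degree g > 0 \<Longrightarrow> degree g = degree \<pi>"
proof -
  define P where "P = (\<lambda>g. g dvd h \<and> degree g > 0)"
  obtain \<pi> where \<pi>: "P \<pi>" "\<And>g. P g \<Longrightarrow> degree \<pi> \<le> degree g"
    using ex_has_least_nat[of P h degree] assms by (auto simp: P_def)
  have "\<pi> \<noteq> 0" "h \<noteq> 0" using \<pi>(1) assms by (auto simp: P_def)
  then have "degree g = degree \<pi>" if "g dvd \<pi>" "degree g > 0" for g
    using \<pi> that dvd_imp_degree_le[OF that(1)] unfolding P_def by (meson dvd_trans le_antisym)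
  then show ?thesis using \<pi>(1) that by (auto simp: P_def)
qed

text \<open>The ideal generated by \<open>g\<close> and \<open>\<pi>\<close> is principal, generated
  by a nonzero element \<open>d\<close> of least degree. As \<open>d\<close> divides
  \<open>\<pi>\<close>, it is a unit or an associate of \<open>\<pi>\<close>, and the latter would
  make \<open>\<pi>\<close> divide \<open>g\<close>.\<close>

lemma bezout_min_degree_divisor:
  fixes \<pi> g :: "'a :: field poly"
  assumes min: "\<And>g. g dvd \<pi> \<Longrightarrow> degree g > 0 \<Longrightarrow> degree g = degree \<pi>" and "\<pi> \<noteq> 0" "\<not> \<pi> dvd g"
  shows "\<exists>s t. s * g + t * \<pi> = 1"
proof -
  define I where "I = {s * g + t * \<pi> | s t. True}"
  \<comment> \<open>Closure under these combinations suffices, since the remainder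
    \<open>e mod d\<close> has this shape.\<close>
  have lin: "x - y * z \<in> I" if "x \<in> I" "z \<in> I" for x y z
  proof -
    obtain s t s' t' where "x = s * g + t * \<pi>" "z = s' * g + t' * \<pi>" using \<open>x \<in> I\<close> \<open>z \<in> I\<close> by (auto simp: I_def)
    then have "x - y * z = (s - y * s') * g + (t - y * t') * \<pi>" by (simp add: algebra_simps)
    then show ?thesis by (auto simp: I_def)
  qed
  have gI: "g \<in> I" unfolding I_def by (rule CollectI, rule exI[of _ 1], rule exI[of _ 0]) simp
  have pI: "\<pi> \<in> I" unfolding I_def by (rule CollectI, rule exI[of _ 0], rule exI[of _ 1]) simp
  obtain d where d: "d \<in> I" "d \<noteq> 0" and dmin: "\<And>e. e \<in> I \<Longrightarrow> e \<noteq> 0 \<Longrightarrow> degree d \<le> degree e"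
    using ex_has_least_nat[of "\<lambda>e. e \<in> I \<and> e \<noteq> 0" \<pi> degree] pI \<open>\<pi> \<noteq> 0\<close> by auto
  have dvd: "d dvd e" if "e \<in> I" for e
  proof -
    have "e mod d = e - (e div d) * d" by (simp add: minus_div_mult_eq_mod)
    then have "e mod d \<in> I" using lin[OF that d(1)] by simp
    then have "e mod d = 0" using dmin[of "e mod d"] degree_mod_less'[of d e] d(2) by linarith
    then show ?thesis by auto
  qed
  have "degree d = 0"
  proof (rule ccontr)
    assume "degree d \<noteq> 0"
    then have "degree d = degree \<pi>" using min[OF dvd[OF pI]] by simp
    moreover obtain c where c: "\<pi> = d * c" using dvd[OF pI] by (rule dvdE)
    ultimately have "degree c = 0" using degree_mult_eq[of d c] d(2) \<open>\<pi> \<noteq> 0\<close> by auto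
    then have "c dvd 1" using c \<open>\<pi> \<noteq> 0\<close> by (auto simp: is_unit_iff_degree)
    then have "\<pi> dvd d" unfolding c by simp
    then show False using dvd[OF gI] \<open>\<not> \<pi> dvd g\<close> dvd_trans by blast
  qed
  then have "d dvd 1" using d(2) by (simp add: is_unit_iff_degree)
  then obtain u where "1 = d * u" by (rule dvdE)
  moreover obtain s t where "d = s * g + t * \<pi>" using d(1) by (auto simp: I_def)
  ultimately have "(u * s) * g + (u * t) * \<pi> = 1" by (simp add: algebra_simps)
  then show ?thesis by blast
qed

text \<open>In the product of the identities for \<open>\<pi> ^ e\<close> and for
  \<open>\<pi>\<close>, the only term without a factor \<open>g\<close> is a multiple of
  \<open>\<pi> ^ Suc e\<close>.\<close>

lemma bezout_power:
  fixes \<pi> g :: "'a :: comm_ring_1"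
  assumes "s * g + t * \<pi> = 1"
  shows "\<exists>s' t'. s' * g + t' * \<pi> ^ e = 1"
proof (induction e)
  case 0
  show ?case by (rule exI[of _ 0], rule exI[of _ 1]) simp
next
  case (Suc e)
  then obtain s' t' where "s' * g + t' * \<pi> ^ e = 1" by blast
  then have "(s' * g + t' * \<pi> ^ e) * (s * g + t * \<pi>) = 1" using assms by simp
  then have "(s' * (s * g + t * \<pi>) + t' * \<pi> ^ e * s) * g + (t' * t) * \<pi> ^ Suc e = 1"
    by (simp add: algebra_simps)
  then show ?case by blast
qed

lemma split_off_power:
  fixes \<pi> h :: "'a :: field poly"
  assumes "degree \<pi> > 0" "h \<noteq> 0"
  shows "\<exists>e h'. h = \<pi> ^ e * h' \<and> \<not> \<pi> dvd h'"
  using assms(2)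
proof (induction "degree h" arbitrary: h rule: less_induct)
  case less
  show ?case
  proof (cases "\<pi> dvd h")
    case False
    then show ?thesis by (intro exI[of _ 0] exI[of _ h]) simp
  next
    case True
    then obtain c where c: "h = \<pi> * c" by (rule dvdE)
    then have "c \<noteq> 0" "degree c < degree h" using less.prems assms(1) by (auto simp: degree_mult_eq)
    from less.hyps[OF this(2,1)] obtain e h' where "c = \<pi> ^ e * h'" "\<not> \<pi> dvd h'" by auto
    then show ?thesis using c by (intro exI[of _ "Suc e"] exI[of _ h']) simp
  qed
qed

section \<open>Matrix polynomials, their action on vectors, and annihilators\<close>

context
  fixes A :: "'a :: field mat" and n :: nat
  assumes A: "A \<in> carrier_mat n n"
begin

lemma poly_mat_eval_dim [simp]: "dim_row (poly_mat_eval q A) = n" "dim_col (poly_mat_eval q A) = n"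
  using poly_mat_eval_carrier[OF A, of q] by auto

lemma poly_mat_eval_0: "poly_mat_eval 0 A = 0\<^sub>m n n"
  by (rule eq_matI) (auto simp: poly_mat_eval_index[OF A _ _ order_refl])

lemma poly_mat_eval_add: "poly_mat_eval (f + g) A = poly_mat_eval f A + poly_mat_eval g A"
proof (rule eq_matI)
  fix i j assume "i < dim_row (poly_mat_eval f A + poly_mat_eval g A)"
    "j < dim_col (poly_mat_eval f A + poly_mat_eval g A)"
  then have ij: "i < n" "j < n" by auto
  let ?d = "max (degree f) (degree g)"
  have "degree (f + g) \<le> ?d" by (rule degree_add_le_max)
  then show "poly_mat_eval (f + g) A $$ (i, j) = (poly_mat_eval f A + poly_mat_eval g A) $$ (i, j)"
    using ij by (simp add: poly_mat_eval_index[OF A ij, of _ ?d] sum.distrib algebra_simps)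
qed auto

lemma pow_mat_Suc_left: "A ^\<^sub>m Suc k = A * A ^\<^sub>m k"
proof (induction k)
  case 0
  show ?case using A by simp
next
  case (Suc k)
  have "A ^\<^sub>m Suc (Suc k) = A * A ^\<^sub>m k * A" using Suc by simp
  also have "\<dots> = A * A ^\<^sub>m Suc k" using A by (simp add: assoc_mult_mat[of A n n _ n A n])
  finally show ?case .
qed

lemma poly_mat_eval_pCons:
  "poly_mat_eval (pCons a f) A = a \<cdot>\<^sub>m 1\<^sub>m n + A * poly_mat_eval f A"
proof (rule eq_matI)
  fix i j assume "i < dim_row (a \<cdot>\<^sub>m 1\<^sub>m n + A * poly_mat_eval f A)"
    "j < dim_col (a \<cdot>\<^sub>m 1\<^sub>m n + A * poly_mat_eval f A)"
  then have ij: "i < n" "j < n" using A by auto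
  have Ae: "(A * poly_mat_eval f A) $$ (i, j) = (\<Sum>k\<le>degree f. coeff f k * (A ^\<^sub>m Suc k) $$ (i, j))"
  proof -
    have "(A * poly_mat_eval f A) $$ (i, j) = (\<Sum>l<n. A $$ (i, l) * poly_mat_eval f A $$ (l, j))"
      using ij A by (simp add: scalar_prod_def atLeast0LessThan)
    also have "\<dots> = (\<Sum>l<n. \<Sum>k\<le>degree f. coeff f k * (A $$ (i, l) * (A ^\<^sub>m k) $$ (l, j)))"
      using ij by (intro sum.cong refl) (simp add: poly_mat_eval_index[OF A _ _ order_refl] sum_distrib_left algebra_simps)
    also have "\<dots> = (\<Sum>k\<le>degree f. coeff f k * (\<Sum>l<n. A $$ (i, l) * (A ^\<^sub>m k) $$ (l, j)))"
      by (subst sum.swap) (simp add: sum_distrib_left)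
    also have "\<dots> = (\<Sum>k\<le>degree f. coeff f k * (A ^\<^sub>m Suc k) $$ (i, j))"
      unfolding pow_mat_Suc_left using ij A
      by (intro sum.cong refl) (simp add: scalar_prod_def atLeast0LessThan)
    finally show ?thesis .
  qed
  have "poly_mat_eval (pCons a f) A $$ (i, j) =
      (\<Sum>k\<le>Suc (degree f). coeff (pCons a f) k * (A ^\<^sub>m k) $$ (i, j))"
    by (rule poly_mat_eval_index[OF A ij degree_pCons_le])
  also have "\<dots> = a * (1\<^sub>m n) $$ (i, j) + (A * poly_mat_eval f A) $$ (i, j)"
    unfolding Ae sum.atMost_Suc_shift using A by simp
  finally show "poly_mat_eval (pCons a f) A $$ (i, j) = (a \<cdot>\<^sub>m 1\<^sub>m n + A * poly_mat_eval f A) $$ (i, j)"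
    using ij A by simp
qed (use A in auto)

lemma poly_mat_eval_smult: "poly_mat_eval (Polynomial.smult a f) A = a \<cdot>\<^sub>m poly_mat_eval f A"
  by (rule eq_matI)
    (auto simp: poly_mat_eval_index[OF A _ _ degree_smult_le] poly_mat_eval_index[OF A _ _ order_refl]
      sum_distrib_left algebra_simps)

lemma poly_mat_eval_mult: "poly_mat_eval (f * g) A = poly_mat_eval f A * poly_mat_eval g A"
proof (induction f)
  case 0
  show ?case unfolding mult_zero_left poly_mat_eval_0
    by (rule left_mult_zero_mat[OF poly_mat_eval_carrier[OF A], symmetric])
next
  case (pCons a f)
  note c = poly_mat_eval_carrier[OF A]
  have "poly_mat_eval (pCons a f * g) A = a \<cdot>\<^sub>m poly_mat_eval g A + poly_mat_eval (pCons 0 (f * g)) A"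
    unfolding mult_pCons_left poly_mat_eval_add poly_mat_eval_smult ..
  also have "poly_mat_eval (pCons 0 (f * g)) A = A * (poly_mat_eval f A * poly_mat_eval g A)"
  proof -
    have "0 \<cdot>\<^sub>m 1\<^sub>m n = (0\<^sub>m n n :: 'a mat)" by (rule eq_matI) auto
    moreover have "A * (poly_mat_eval f A * poly_mat_eval g A) \<in> carrier_mat n n"
      by (rule mult_carrier_mat[OF A mult_carrier_mat[OF c c]])
    ultimately show ?thesis unfolding poly_mat_eval_pCons pCons.IH by (metis left_add_zero_mat)
  qed
  also have "\<dots> = A * poly_mat_eval f A * poly_mat_eval g A"
    by (rule assoc_mult_mat[OF A c c, symmetric])
  also have "a \<cdot>\<^sub>m poly_mat_eval g A = (a \<cdot>\<^sub>m 1\<^sub>m n) * poly_mat_eval g A"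
    by (subst mult_smult_assoc_mat[OF one_carrier_mat c]) (simp add: left_mult_one_mat[OF c])
  also have "\<dots> + A * poly_mat_eval f A * poly_mat_eval g A =
      (a \<cdot>\<^sub>m 1\<^sub>m n + A * poly_mat_eval f A) * poly_mat_eval g A"
    by (rule add_mult_distrib_mat[symmetric, OF _ _ c]) (auto intro: mult_carrier_mat[OF A c])
  finally show ?case unfolding poly_mat_eval_pCons .
qed

text \<open>Vectors become a module over the polynomials, with the variable acting as
  \<open>A\<close>; annihilators below are meant in this module.\<close>

definition poly_act :: "'a poly \<Rightarrow> 'a vec \<Rightarrow> 'a vec" where
  "poly_act f v = poly_mat_eval f A *\<^sub>v v"

lemma poly_act_carrier [simp]: "poly_act f v \<in> carrier_vec n"
  unfolding poly_act_def by (rule carrier_vecI) simp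

lemma poly_act_add: "v \<in> carrier_vec n \<Longrightarrow> poly_act (f + g) v = poly_act f v + poly_act g v"
  unfolding poly_act_def poly_mat_eval_add by (rule add_mult_distrib_mat_vec) (auto intro: poly_mat_eval_carrier[OF A])

lemma poly_act_add_vec: "v \<in> carrier_vec n \<Longrightarrow> w \<in> carrier_vec n \<Longrightarrow> poly_act f (v + w) = poly_act f v + poly_act f w"
  unfolding poly_act_def by (rule mult_add_distrib_mat_vec) (auto intro: poly_mat_eval_carrier[OF A])

lemma poly_act_mult: "v \<in> carrier_vec n \<Longrightarrow> poly_act (f * g) v = poly_act f (poly_act g v)"
  unfolding poly_act_def poly_mat_eval_mult
  by (rule assoc_mult_mat_vec) (auto intro: poly_mat_eval_carrier[OF A])

lemma poly_act_smult: "v \<in> carrier_vec n \<Longrightarrow> poly_act (Polynomial.smult a f) v = a \<cdot>\<^sub>v poly_act f v"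
  unfolding poly_act_def poly_mat_eval_smult using poly_mat_eval_carrier[OF A, of f]
  by (intro eq_vecI) auto

lemma poly_act_0: "v \<in> carrier_vec n \<Longrightarrow> poly_act 0 v = 0\<^sub>v n"
  unfolding poly_act_def poly_mat_eval_0 by (intro eq_vecI) auto

lemma poly_act_zero_vec: "poly_act f (0\<^sub>v n) = 0\<^sub>v n"
  unfolding poly_act_def using poly_mat_eval_carrier[OF A, of f] by (intro eq_vecI) auto

lemma poly_act_pCons:
  assumes v: "v \<in> carrier_vec n"
  shows "poly_act (pCons a f) v = a \<cdot>\<^sub>v v + A *\<^sub>v poly_act f v"
proof -
  note c = poly_mat_eval_carrier[OF A, of f]
  have "(a \<cdot>\<^sub>m 1\<^sub>m n + A * poly_mat_eval f A) *\<^sub>v v = (a \<cdot>\<^sub>m 1\<^sub>m n) *\<^sub>v v + (A * poly_mat_eval f A) *\<^sub>v v"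
    by (rule add_mult_distrib_mat_vec[OF _ mult_carrier_mat[OF A c] v]) simp
  also have "(a \<cdot>\<^sub>m 1\<^sub>m n) *\<^sub>v v = a \<cdot>\<^sub>v v"
    using v by (intro eq_vecI) auto
  also have "(A * poly_mat_eval f A) *\<^sub>v v = A *\<^sub>v (poly_mat_eval f A *\<^sub>v v)"
    by (rule assoc_mult_mat_vec[OF A c v])
  finally show ?thesis unfolding poly_act_def poly_mat_eval_pCons .
qed

lemma poly_act_1:
  assumes v: "v \<in> carrier_vec n"
  shows "poly_act 1 v = v"
proof -
  have "A *\<^sub>v 0\<^sub>v n = 0\<^sub>v n" using A by (intro eq_vecI) auto
  then show ?thesis using v by (simp add: one_pCons poly_act_pCons poly_act_0)
qed

text \<open>If \<open>g\<close> kills \<open>v + w\<close>, then \<open>b * g\<close> kills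
  \<open>v\<close>, because it already kills \<open>w\<close>. So \<open>a\<close> divides
  \<open>b * g\<close>, and by coprimality \<open>g\<close>; symmetrically for
  \<open>b\<close>.\<close>

lemma annihilator_sum:
  assumes v: "v \<in> carrier_vec n" and w: "w \<in> carrier_vec n"
    and bez: "s * a + t * b = 1"
    and anv: "poly_act a v = 0\<^sub>v n" "\<And>g. poly_act g v = 0\<^sub>v n \<Longrightarrow> a dvd g"
    and anw: "poly_act b w = 0\<^sub>v n" "\<And>g. poly_act g w = 0\<^sub>v n \<Longrightarrow> b dvd g"
  shows "poly_act (a * b) (v + w) = 0\<^sub>v n" "poly_act g (v + w) = 0\<^sub>v n \<Longrightarrow> a * b dvd g"
proof -
  have bw: "poly_act (f * b) w = 0\<^sub>v n" for f using w anw(1) by (simp add: poly_act_mult poly_act_zero_vec)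
  have av: "poly_act (f * a) v = 0\<^sub>v n" for f using v anv(1) by (simp add: poly_act_mult poly_act_zero_vec)
  show "poly_act (a * b) (v + w) = 0\<^sub>v n"
    using bw[of a] av[of b] v w by (simp add: poly_act_add_vec mult.commute)
  assume g: "poly_act g (v + w) = 0\<^sub>v n"
  have g0: "poly_act (f * g) v + poly_act (f * g) w = 0\<^sub>v n" for f
    using g v w by (simp add: poly_act_add_vec[symmetric] poly_act_mult poly_act_zero_vec)
  have "poly_act (b * g) v = 0\<^sub>v n" using g0[of b] bw[of g] by (simp add: mult.commute)
  then have "a dvd b * g" by (rule anv(2))
  then have a: "a dvd s * a * g + t * (b * g)" by (rule dvd_add[OF dvd_mult2[OF dvd_mult[OF dvd_refl]] dvd_mult])
  have "poly_act (a * g) w = 0\<^sub>v n" using g0[of a] av[of g] by (simp add: mult.commute)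
  then have "b dvd a * g" by (rule anw(2))
  then have b: "b dvd s * (a * g) + t * b * g" by (rule dvd_add[OF dvd_mult dvd_mult2[OF dvd_mult[OF dvd_refl]]])
  have geq: "g = s * a * g + t * b * g" using bez by (metis distrib_right mult_1)
  have "a dvd g" "b dvd g" using a b geq by (simp_all add: mult.assoc)
  \<comment> \<open>This sum is the Bezout identity multiplied by \<open>g\<close>; the first
    summand is a multiple of \<open>a * b\<close> by \<open>b dvd g\<close>, the second by
    \<open>a dvd g\<close>.\<close>
  have "a * b dvd s * (a * g) + t * (g * b)"
    using dvd_mult[OF mult_dvd_mono[OF dvd_refl \<open>b dvd g\<close>]] dvd_mult[OF mult_dvd_mono[OF \<open>a dvd g\<close> dvd_refl]]
    by (rule dvd_add)
  then show "a * b dvd g" using geq by (simp add: mult.assoc mult.commute[of g b])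
qed

text \<open>Write \<open>g\<close> as \<open>\<pi> ^ j\<close> times a cofactor not divisible by
  \<open>\<pi>\<close>. Bezout makes \<open>\<pi> ^ j\<close> a combination of \<open>g\<close> and
  \<open>\<pi> ^ Suc e\<close>, so it kills \<open>v\<close>, which forces
  \<open>j > e\<close>.\<close>

lemma annihilator_prime_power:
  assumes min: "\<And>g. g dvd \<pi> \<Longrightarrow> degree g > 0 \<Longrightarrow> degree g = degree \<pi>" and "degree \<pi> > 0"
    and v: "v \<in> carrier_vec n"
    and e: "poly_act (\<pi> ^ Suc e) v = 0\<^sub>v n" "poly_act (\<pi> ^ e) v \<noteq> 0\<^sub>v n"
    and g: "poly_act g v = 0\<^sub>v n"
  shows "\<pi> ^ Suc e dvd g"
proof (cases "g = 0")
  case False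
  have "\<pi> \<noteq> 0" using assms(2) by auto
  obtain j g' where g': "g = \<pi> ^ j * g'" "\<not> \<pi> dvd g'" using split_off_power[OF assms(2) False] by blast
  obtain s t where "s * g' + t * \<pi> ^ Suc e = 1"
    using bezout_min_degree_divisor[OF min \<open>\<pi> \<noteq> 0\<close> g'(2)] bezout_power by metis
  then have "\<pi> ^ j = \<pi> ^ j * (s * g' + t * \<pi> ^ Suc e)" by simp
  then have "\<pi> ^ j = s * g + \<pi> ^ j * t * \<pi> ^ Suc e" unfolding g'(1) by (simp add: algebra_simps)
  then have "poly_act (\<pi> ^ j) v = poly_act s (poly_act g v) + poly_act (\<pi> ^ j * t) (poly_act (\<pi> ^ Suc e) v)"
    using v by (metis poly_act_add poly_act_mult)
  then have j: "poly_act (\<pi> ^ j) v = 0\<^sub>v n" by (simp only: g e(1) poly_act_zero_vec) simp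
  have "\<not> j \<le> e"
  proof
    assume "j \<le> e"
    then have "\<pi> ^ e = \<pi> ^ (e - j) * \<pi> ^ j" by (simp add: power_add[symmetric])
    then show False using e(2) v j by (metis poly_act_mult poly_act_zero_vec)
  qed
  then have "\<pi> ^ Suc e dvd \<pi> ^ j" by (intro le_imp_power_dvd) simp
  then show ?thesis unfolding g'(1) by simp
qed simp

lemma nonzero_action:
  assumes "poly_mat_eval f A \<noteq> 0\<^sub>m n n"
  obtains w where "w \<in> carrier_vec n" "poly_act f w \<noteq> 0\<^sub>v n"
proof -
  have "\<exists>j<n. poly_act f (unit_vec n j) \<noteq> 0\<^sub>v n"
  proof (rule ccontr)
    assume "\<not> ?thesis"
    then have "poly_mat_eval f A $$ (i, j) = 0" if "i < n" "j < n" for i j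
      using that by (auto simp: poly_act_def vec_eq_iff)
    then have "poly_mat_eval f A = 0\<^sub>m n n" by (intro eq_matI) auto
    then show False using assms by simp
  qed
  then show ?thesis using that unit_vec_carrier by blast
qed

text \<open>By induction on \<open>h\<close>: split off a maximal power \<open>\<pi>\<^sup>e\<close> of an irreducible factor and add to the
  vector for the cofactor a vector with annihilator \<open>\<pi>\<^sup>e\<close>, namely \<open>(f / \<pi>\<^sup>e)(A) w\<close> with
  \<open>(f / \<pi>)(A) w \<noteq> 0\<close>. Unlike a generic choice of vector, this works over finite fields.\<close>

lemma divisor_is_annihilator:
  assumes f0: "poly_mat_eval f A = 0\<^sub>m n n" "f \<noteq> 0"
    and min: "\<And>r. r \<noteq> 0 \<Longrightarrow> poly_mat_eval r A = 0\<^sub>m n n \<Longrightarrow> degree f \<le> degree r"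
    and "h dvd f"
  shows "\<exists>v\<in>carrier_vec n. poly_act h v = 0\<^sub>v n \<and> (\<forall>g. poly_act g v = 0\<^sub>v n \<longrightarrow> h dvd g)"
  using \<open>h dvd f\<close>
proof (induction "degree h" arbitrary: h rule: less_induct)
  case less
  have h0: "h \<noteq> 0" using less.prems f0(2) by auto
  show ?case
  proof (cases "degree h = 0")
    case True
    then have "h dvd 1" using h0 by (simp add: is_unit_iff_degree)
    then have "h dvd g" for g by (rule unit_imp_dvd)
    then show ?thesis by (intro bexI[of _ "0\<^sub>v n"]) (auto simp: poly_act_zero_vec)
  next
    case False
    then obtain \<pi> where \<pi>: "\<pi> dvd h" "degree \<pi> > 0"
        "\<And>g. g dvd \<pi> \<Longrightarrow> degree g > 0 \<Longrightarrow> degree g = degree \<pi>"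
      using min_degree_divisor[of h] by blast
    then have \<pi>0: "\<pi> \<noteq> 0" by auto
    obtain e' h' where eh': "h = \<pi> ^ e' * h'" "\<not> \<pi> dvd h'" using split_off_power[OF \<pi>(2) h0] by blast
    then have "e' \<noteq> 0" using \<pi>(1) by (cases e') auto
    \<comment> \<open>The full exponent is \<open>Suc e\<close>, so with
      \<open>f = \<pi> ^ Suc e * c\<close> below, \<open>\<pi> ^ e * c\<close> is the quotient of
      \<open>f\<close> by a single factor \<open>\<pi>\<close>.\<close>
    then obtain e where e: "h = \<pi> ^ Suc e * h'" using eh'(1) not0_implies_Suc by blast
    have h'0: "h' \<noteq> 0" using h0 e by auto
    have "degree h' < degree h" unfolding e using h'0 \<pi>0 \<pi>(2)
      by (simp add: degree_mult_eq degree_power_eq)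
    moreover have "h' dvd f" using less.prems e dvd_mult_right by blast
    ultimately obtain v where v: "v \<in> carrier_vec n" "poly_act h' v = 0\<^sub>v n" "\<And>g. poly_act g v = 0\<^sub>v n \<Longrightarrow> h' dvd g"
      using less.hyps by blast
    obtain c where c: "f = \<pi> ^ Suc e * c" using less.prems e by (metis dvdE mult.assoc)
    have "c \<noteq> 0" using c f0(2) by auto
    then have "degree (\<pi> ^ e * c) < degree f" unfolding c using \<pi>0 \<pi>(2)
      by (simp add: degree_mult_eq degree_power_eq)
    then have "poly_mat_eval (\<pi> ^ e * c) A \<noteq> 0\<^sub>m n n" using min[of "\<pi> ^ e * c"] \<open>c \<noteq> 0\<close> \<pi>0 by auto
    then obtain w where w: "w \<in> carrier_vec n" "poly_act (\<pi> ^ e * c) w \<noteq> 0\<^sub>v n" by (rule nonzero_action)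
    define u where "u = poly_act c w"
    have u: "u \<in> carrier_vec n" by (simp add: u_def)
    have ue: "poly_act (\<pi> ^ e) u \<noteq> 0\<^sub>v n" using w by (simp add: u_def poly_act_mult)
    have "poly_act (\<pi> ^ Suc e) u = poly_act f w" unfolding u_def c by (rule poly_act_mult[symmetric, OF w(1)])
    also have "\<dots> = 0\<^sub>v n" using poly_act_0[OF w(1)] by (simp add: poly_act_def f0(1) poly_mat_eval_0)
    finally have uSe: "poly_act (\<pi> ^ Suc e) u = 0\<^sub>v n" .
    obtain s t where "s * h' + t * \<pi> ^ Suc e = 1"
      using bezout_min_degree_divisor[OF \<pi>(3) \<pi>0 eh'(2)] bezout_power by metis
    then have bez: "t * \<pi> ^ Suc e + s * h' = 1" by (simp add: add.commute)
    have pp: "\<pi> ^ Suc e dvd g" if "poly_act g u = 0\<^sub>v n" for g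
      by (rule annihilator_prime_power[OF _ \<pi>(2) u uSe ue that]) (rule \<pi>(3))
    have "poly_act h (u + v) = 0\<^sub>v n"
      unfolding e by (rule annihilator_sum(1)[OF u v(1) bez uSe pp v(2,3)])
    moreover have "h dvd g" if "poly_act g (u + v) = 0\<^sub>v n" for g
      unfolding e by (rule annihilator_sum(2)[OF u v(1) bez uSe pp v(2,3) that])
    moreover have "u + v \<in> carrier_vec n" using u v(1) by simp
    ultimately show ?thesis by blast
  qed
qed

end

text \<open>The characteristic polynomial, being minimal, is a divisor of itself and hence the
  annihilator of some vector; its degree is \<open>n\<close>.\<close>

lemma nonderogatory_cyclic_vector:
  fixes A :: "'a :: field mat"
  assumes A: "A \<in> carrier_mat n n" and "nonderogatory A"
  obtains v where "v \<in> carrier_vec n" "\<And>g. poly_mat_eval g A *\<^sub>v v = 0\<^sub>v n \<Longrightarrow> degree g < n \<Longrightarrow> g = 0"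
proof -
  let ?f = "char_poly A"
  have deg: "degree ?f = n" "monic ?f" using degree_monic_char_poly[OF A] by auto
  have mp: "is_min_poly A ?f" using assms(2) by (simp add: nonderogatory_def)
  have dA: "dim_row A = n" using A by auto
  have "poly_mat_eval ?f A = 0\<^sub>m n n" using mp dA by (simp add: is_min_poly_def)
  moreover have "?f \<noteq> 0" using deg(2) by auto
  moreover have "degree ?f \<le> degree r" if "r \<noteq> 0" "poly_mat_eval r A = 0\<^sub>m n n" for r
  proof -
    \<comment> \<open>Minimality in \<open>is_min_poly\<close> compares monic polynomials only, so
      \<open>r\<close> is normalised.\<close>
    let ?r = "Polynomial.smult (inverse (lead_coeff r)) r"
    have "monic ?r" using that(1) by simp
    moreover have "poly_mat_eval ?r A = 0\<^sub>m n n" using that(2) by (simp add: poly_mat_eval_smult[OF A])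
    ultimately have "degree ?f \<le> degree ?r" using mp dA unfolding is_min_poly_def by blast
    then show ?thesis using that(1) by simp
  qed
  ultimately obtain v where "v \<in> carrier_vec n" "\<And>g. poly_act A g v = 0\<^sub>v n \<Longrightarrow> ?f dvd g"
    using divisor_is_annihilator[OF A, of ?f ?f] by auto
  then show ?thesis using that unfolding poly_act_def[OF A] deg(1)[symmetric]
    by (metis dvd_imp_degree_le not_less)
qed

subsection \<open>Hessenberg form with prescribed diagonal\<close>

lemma mat_trace_mult_comm:
  fixes X Y :: "'a :: comm_ring_1 mat"
  assumes "X \<in> carrier_mat n n" "Y \<in> carrier_mat n n"
  shows "mat_trace (X * Y) = mat_trace (Y * X)"
proof -
  have tr: "mat_trace (U * W) = (\<Sum>i<n. \<Sum>j<n. U $$ (i, j) * W $$ (j, i))"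
    if "U \<in> carrier_mat n n" "W \<in> carrier_mat n n" for U W :: "'a mat"
    using that by (auto simp: mat_trace_def scalar_prod_def atLeast0LessThan intro!: sum.cong)
  show ?thesis unfolding tr[OF assms] tr[OF assms(2,1)]
    by (subst sum.swap) (simp add: mult.commute)
qed

text \<open>The coefficient of highest degree isolates the last scalar, so the terms can be removed
  one by one.\<close>

lemma monic_graded_independent:
  fixes q :: "nat \<Rightarrow> 'a :: comm_ring_1 poly"
  assumes "\<And>j. degree (q j) = j" "\<And>j. coeff (q j) j = 1"
    and "(\<Sum>j<k. Polynomial.smult (c j) (q j)) = 0" "j < k"
  shows "c j = 0"
  using assms(3,4)
proof (induction k)
  case (Suc k)
  have "coeff (\<Sum>j<k. Polynomial.smult (c j) (q j)) k = 0"
    by (simp add: coeff_sum coeff_eq_0 assms(1))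
  then have "coeff (\<Sum>j<Suc k. Polynomial.smult (c j) (q j)) k = c k" by (simp add: assms(2))
  then have "c k = 0" unfolding Suc.prems(1) by simp
  then show ?case using Suc by (cases "j = k") auto
qed simp

lemma poly_act_sum_index:
  fixes k :: nat
  assumes A: "(A :: 'a :: field mat) \<in> carrier_mat n n" and v: "v \<in> carrier_vec n" and "i < n"
  shows "poly_act A (\<Sum>j<k. Polynomial.smult (c j) (q j)) v $ i = (\<Sum>j<k. c j * poly_act A (q j) v $ i)"
proof (induction k)
  case 0
  show ?case using \<open>i < n\<close> by (simp add: poly_act_0[OF A v])
next
  case (Suc k)
  have "poly_act A f v \<in> carrier_vec n" for f by (rule poly_act_carrier[OF A])
  then have "i < dim_vec (poly_act A f v)" for f using \<open>i < n\<close> by (metis carrier_vecD)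
  then show ?case using Suc by (simp add: poly_act_add[OF A v] poly_act_smult[OF A v])
qed

text \<open>The columns of \<open>P\<close> are the vectors \<open>q j\<close> applied to the cyclic
  vector, a Newton basis. Multiplying \<open>q b\<close> by the variable gives
  \<open>q (Suc b)\<close> plus \<open>d b\<close> times \<open>q b\<close>, which is column
  \<open>b\<close> of \<open>H\<close>. For \<open>b = n - 1\<close> the polynomial
  \<open>q n\<close> falls outside the basis.\<close>

lemma nonderogatory_hessenberg_form:
  fixes A :: "'a :: field mat" and d :: "nat \<Rightarrow> 'a"
  assumes A: "A \<in> carrier_mat n n" and "nonderogatory A"
  obtains H P Q where "H \<in> carrier_mat n n" "P \<in> carrier_mat n n" "Q \<in> carrier_mat n n"
    "P * Q = 1\<^sub>m n" "Q * P = 1\<^sub>m n" "A = P * H * Q"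
    "\<And>a b. a < n \<Longrightarrow> Suc b < n \<Longrightarrow> H $$ (a, b) = (if a = b then d b else if a = Suc b then 1 else 0)"
proof -
  obtain v where v: "v \<in> carrier_vec n" "\<And>g. poly_act A g v = 0\<^sub>v n \<Longrightarrow> degree g < n \<Longrightarrow> g = 0"
    using nonderogatory_cyclic_vector[OF assms] unfolding poly_act_def[OF A] by metis
  define q where "q = (\<lambda>j. \<Prod>i<j. [:- d i, 1:])"
  have qSuc: "q (Suc j) = [:- d j, 1:] * q j" for j by (simp add: q_def mult.commute)
  have q: "degree (q j) = j" "coeff (q j) j = 1" for j
  proof -
    have "monic (q j)" unfolding q_def by (rule monic_prod) simp
    moreover show "degree (q j) = j" unfolding q_def
      by (subst degree_prod_eq_sum_degree) auto
    ultimately show "coeff (q j) j = 1" by simp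
  qed
  define P where "P = mat n n (\<lambda>(i, j). poly_act A (q j) v $ i)"
  have P: "P \<in> carrier_mat n n" by (simp add: P_def)
  note ac = poly_act_carrier[OF A]
  have colP: "col P j = poly_act A (q j) v" if "j < n" for j
    using that carrier_vecD[OF ac[of "q j" v]] by (intro eq_vecI) (auto simp: P_def)
  \<comment> \<open>A kernel vector of \<open>P\<close> lists the coefficients of a combination of
    the \<open>q j\<close>, of degree below \<open>n\<close>, that kills \<open>v\<close>.\<close>
  have "det P \<noteq> 0"
  proof
    assume "det P = 0"
    then obtain c where c: "c \<in> carrier_vec n" "c \<noteq> 0\<^sub>v n" "P *\<^sub>v c = 0\<^sub>v n"
      using det_0_iff_vec_prod_zero_field[OF P] by auto
    let ?g = "\<Sum>j<n. Polynomial.smult (c $ j) (q j)"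
    have n0: "0 < n" using c(1,2) by (cases n) auto
    have "poly_act A ?g v $ i = (P *\<^sub>v c) $ i" if "i < n" for i
      unfolding poly_act_sum_index[OF A v(1) that] using that c(1)
      by (simp add: P_def scalar_prod_def atLeast0LessThan mult.commute)
    then have "poly_act A ?g v = 0\<^sub>v n" using c(3) carrier_vecD[OF ac[of ?g v]] by (intro eq_vecI) auto
    moreover have "degree ?g \<le> n - 1"
      by (intro degree_sum_le) (auto intro!: order.trans[OF degree_smult_le] simp: q)
    then have "degree ?g < n" using n0 by simp
    ultimately have "?g = 0" by (rule v(2))
    then have "c $ j = 0" if "j < n" for j using monic_graded_independent[of q "\<lambda>j. c $ j" n j] q that by blast
    then have "c = 0\<^sub>v n" using c(1) by (intro eq_vecI) auto
    then show False using c(2) by simp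
  qed
  then have "P \<in> Units (ring_mat TYPE('a) n ())" by (rule det_non_zero_imp_unit[OF P])
  then obtain Q where Q: "Q \<in> carrier_mat n n" "P * Q = 1\<^sub>m n" "Q * P = 1\<^sub>m n"
    unfolding Units_def ring_mat_def by auto
  define H where "H = Q * (A * P)"
  have H: "H \<in> carrier_mat n n" using A P Q(1) by (simp add: H_def)
  have "P * H * Q = (P * Q) * A * (P * Q)"
    unfolding H_def using A P Q(1) by (simp add: assoc_mult_mat[of _ n n _ n _ n])
  then have "A = P * H * Q" using A Q(2) by simp
  moreover have "H $$ (a, b) = (if a = b then d b else if a = Suc b then 1 else 0)"
    if ab: "a < n" "Suc b < n" for a b
  proof -
    let ?w = "poly_act A (q b) v"
    have "poly_act A (q (Suc b)) v = poly_act A [:- d b, 1:] ?w" unfolding qSuc by (rule poly_act_mult[OF A v(1)])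
    also have "\<dots> = (- d b) \<cdot>\<^sub>v ?w + A *\<^sub>v poly_act A 1 ?w"
      unfolding one_pCons by (rule poly_act_pCons[OF A ac])
    also have "poly_act A 1 ?w = ?w" by (rule poly_act_1[OF A ac])
    finally have qb: "poly_act A (q (Suc b)) v = (- d b) \<cdot>\<^sub>v ?w + A *\<^sub>v ?w" .
    have dw: "dim_vec ?w = n" by (rule carrier_vecD[OF ac])
    have Aw: "A *\<^sub>v ?w = poly_act A (q (Suc b)) v + d b \<cdot>\<^sub>v ?w"
      unfolding qb using A by (intro eq_vecI) (simp_all add: dw)
    have QP: "Q *\<^sub>v poly_act A (q j) v = unit_vec n j" if "j < n" for j
      using that col_mult2[OF Q(1) P that] colP Q(3) by simp
    have "col H b = Q *\<^sub>v col (A * P) b"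
      unfolding H_def using ab A P by (intro col_mult2[OF Q(1)]) auto
    also have "col (A * P) b = A *\<^sub>v ?w" using col_mult2[OF A P, of b] ab colP by simp
    also have "Q *\<^sub>v \<dots> = Q *\<^sub>v poly_act A (q (Suc b)) v + Q *\<^sub>v (d b \<cdot>\<^sub>v ?w)"
      unfolding Aw using ac by (intro mult_add_distrib_mat_vec[OF Q(1)]) auto
    also have "\<dots> = unit_vec n (Suc b) + d b \<cdot>\<^sub>v unit_vec n b"
      using ab by (simp add: QP mult_mat_vec[OF Q(1) ac])
    finally have "col H b $ a = (unit_vec n (Suc b) + d b \<cdot>\<^sub>v unit_vec n b) $ a" by simp
    then show ?thesis using ab H by (auto simp: unit_vec_def)
  qed
  ultimately show ?thesis using that[OF H P Q] by blast
qed

subsection \<open>Splitting a Hessenberg matrix into idempotents and a nilpotent\<close>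

text \<open>With \<open>D\<close> the diagonal projection onto \<open>S\<close>, the first condition
  gives \<open>D * N + N * D = N\<close> and the second \<open>N * N = 0\<close>, so
  \<open>D + N\<close> squares to itself.\<close>

lemma idempotent_mat_diag_add:
  fixes N :: "nat \<Rightarrow> nat \<Rightarrow> 'a :: comm_ring_1"
  assumes N: "\<And>a b. N a b \<noteq> 0 \<Longrightarrow> (a \<in> S) \<noteq> (b \<in> S)" and NN: "\<And>a b c. N a c = 0 \<or> N c b = 0"
  shows "idempotent_mat (mat n n (\<lambda>(a, b). of_bool (a = b \<and> a \<in> S) + N a b))" (is "idempotent_mat ?E")
proof -
  have NN': "N a c * N c b = 0" "N c b * N a c = 0" for a b c using NN[of a c b] by auto
  have "(?E * ?E) $$ (a, b) = ?E $$ (a, b)" if ab: "a < n" "b < n" for a b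
  proof -
    have "(?E * ?E) $$ (a, b) = (\<Sum>c<n. (of_bool (a = c \<and> a \<in> S) + N a c) * (of_bool (c = b \<and> c \<in> S) + N c b))"
      using ab by (simp add: scalar_prod_def atLeast0LessThan)
    also have "\<dots> = (\<Sum>c<n. (if c = a then of_bool (a = b \<and> a \<in> S) + of_bool (a \<in> S) * N a b else 0)
        + (if c = b then N a b * of_bool (b \<in> S) else 0))"
      by (intro sum.cong refl) (auto simp: algebra_simps NN')
    also have "\<dots> = of_bool (a = b \<and> a \<in> S) + of_bool (a \<in> S) * N a b + N a b * of_bool (b \<in> S)"
      using ab by (simp add: sum.distrib)
    also have "\<dots> = of_bool (a = b \<and> a \<in> S) + N a b" using N[of a b] by auto
    finally show ?thesis using ab by simp
  qed
  then have "?E * ?E = ?E" by (intro eq_matI) auto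
  then show ?thesis by (simp add: idempotent_mat_def)
qed

text \<open>\<open>V\<close> moves position \<open>b\<close> to \<open>Suc b\<close> unless that row
  is cut. A nonzero entry of \<open>V ^\<^sub>m k\<close> is thus a walk of \<open>k\<close> steps
  entering no row of \<open>R\<close>; the induction removes its first step.\<close>

lemma cut_shift_mat_power:
  fixes R :: "nat set" and n :: nat
  defines "V \<equiv> mat n n (\<lambda>(a, b). of_bool (a = Suc b \<and> a \<notin> R)) :: 'a :: comm_ring_1 mat"
  assumes "a < n" "b < n" "(V ^\<^sub>m k) $$ (a, b) \<noteq> 0"
  shows "a = b + k \<and> (\<forall>r\<in>R. \<not> (b < r \<and> r \<le> b + k))"
  using assms(2-)
proof (induction k arbitrary: b)
  case 0
  then show ?case by (auto simp: V_def one_mat_def split: if_splits)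
next
  case (Suc k)
  have V: "V \<in> carrier_mat n n" by (simp add: V_def)
  have "(V ^\<^sub>m Suc k) $$ (a, b) = (\<Sum>c<n. (V ^\<^sub>m k) $$ (a, c) * V $$ (c, b))"
    using Suc.prems V by (simp add: scalar_prod_def atLeast0LessThan)
  then obtain c where c: "c < n" "(V ^\<^sub>m k) $$ (a, c) \<noteq> 0" "V $$ (c, b) \<noteq> 0"
    using Suc.prems(3) by (metis (no_types, lifting) lessThan_iff mult_zero_left mult_zero_right sum.neutral)
  then have "c = Suc b" "c \<notin> R" using Suc.prems by (auto simp: V_def split: if_splits)
  then show ?case using Suc.IH[OF Suc.prems(1) c(1,2)]
    by (metis Suc_leI add_Suc_shift le_neq_implies_less)
qed

text \<open>\<open>S i\<close> is the set of positions of the diagonal ones of the \<open>i\<close>-th idempotent, and \<open>R\<close> is the set of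
  rows whose subdiagonal one goes to the second idempotent instead of the nilpotent part.\<close>

lemma hessenberg_idempotents_nilpotent:
  fixes H :: "'a :: comm_ring_1 mat" and S :: "nat \<Rightarrow> nat set"
  assumes H: "H \<in> carrier_mat n n" and "m \<ge> 2"
    and Hent: "\<And>a b. a < n \<Longrightarrow> Suc b < n \<Longrightarrow>
      H $$ (a, b) = (if a = b then \<Sum>i=1..m. of_bool (b \<in> S i) else if a = Suc b then 1 else 0)"
    and Hlast: "H $$ (n - 1, n - 1) = (\<Sum>i=1..m. of_bool (n - 1 \<in> S i))"
    and S1: "S 1 = {..<n - 1} \<or> S 1 = {n - 1}"
    and S2: "R \<subseteq> S 2" "\<And>b. Suc b \<in> R \<Longrightarrow> b \<notin> S 2"
    and gap: "\<And>b. b + k < n \<Longrightarrow> \<exists>r\<in>R. b < r \<and> r \<le> b + k"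
  obtains E V where "\<And>i. E i \<in> carrier_mat n n" "\<And>i. idempotent_mat (E i)" "V \<in> carrier_mat n n"
    "H = (\<Oplus>\<^bsub>ring_mat TYPE('a) n ()\<^esub>i\<in>{1..m}. E i) + V" "V ^\<^sub>m k = 0\<^sub>m n n"
proof -
  \<comment> \<open>The first part joins earlier positions to \<open>n - 1\<close>, which
    \<open>S 1\<close> separates; the second joins a cut row, inside \<open>S 2\<close>, to its
    predecessor, outside \<open>S 2\<close>. Hence both satisfy the criterion for
    idempotents.\<close>
  define N where "N = (\<lambda>(i::nat) a b. if i = 1 \<and> a < n - 1 \<and> b = n - 1 then H $$ (a, b)
    else if i = 2 \<and> a \<in> R \<and> a = Suc b then 1 else 0)"
  define E where "E = (\<lambda>i. mat n n (\<lambda>(a, b). of_bool (a = b \<and> a \<in> S i) + N i a b))"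
  define V where "V = (mat n n (\<lambda>(a, b). of_bool (a = Suc b \<and> a \<notin> R)) :: 'a mat)"
  have E: "E i \<in> carrier_mat n n" for i by (simp add: E_def)
  have V: "V \<in> carrier_mat n n" by (simp add: V_def)
  have idem: "idempotent_mat (E i)" for i
    unfolding E_def
  proof (rule idempotent_mat_diag_add)
    show "(a \<in> S i) \<noteq> (b \<in> S i)" if "N i a b \<noteq> 0" for a b
      using that S1 S2 unfolding N_def by (auto split: if_splits)
    show "N i a c = 0 \<or> N i c b = 0" for a b c
      using S2 unfolding N_def by auto
  qed
  have "V ^\<^sub>m k = 0\<^sub>m n n"
  proof (rule eq_matI)
    fix a b assume "a < dim_row (0\<^sub>m n n :: 'a mat)" "b < dim_col (0\<^sub>m n n :: 'a mat)"
    then have ab: "a < n" "b < n" by auto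
    have "(V ^\<^sub>m k) $$ (a, b) = 0"
    proof (rule ccontr)
      assume "(V ^\<^sub>m k) $$ (a, b) \<noteq> 0"
      then have "a = b + k" "\<forall>r\<in>R. \<not> (b < r \<and> r \<le> b + k)"
        using cut_shift_mat_power[OF ab, of R k] unfolding V_def by auto
      then show False using gap[of b] ab(1) by blast
    qed
    then show "(V ^\<^sub>m k) $$ (a, b) = 0\<^sub>m n n $$ (a, b)" using ab by simp
  qed (use V in auto)
  moreover have "H = (\<Oplus>\<^bsub>ring_mat TYPE('a) n ()\<^esub>i\<in>{1..m}. E i) + V" (is "_ = ?F + V")
  proof (rule eq_matI)
    fix a b assume "a < dim_row (?F + V)" "b < dim_col (?F + V)"
    then have ab: "a < n" "b < n" using V by auto
    have m12: "1 \<in> {1..m}" "2 \<in> {1..m}" using \<open>m \<ge> 2\<close> by auto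
    have "?F $$ (a, b) = (\<Sum>i=1..m. E i $$ (a, b))"
      by (rule finsum_mat_index(2)) (use E ab in auto)
    also have "\<dots> = (\<Sum>i=1..m. of_bool (a = b \<and> a \<in> S i)) + (\<Sum>i=1..m. N i a b)"
      using ab by (simp add: E_def sum.distrib)
    also have "(\<Sum>i=1..m. N i a b) =
        (\<Sum>i=1..m. (if i = 1 then (if a < n - 1 \<and> b = n - 1 then H $$ (a, b) else 0) else 0)
          + (if i = 2 then (if a \<in> R \<and> a = Suc b then 1 else 0) else 0))"
      unfolding N_def by (intro sum.cong refl) auto
    also have "\<dots> = (if a < n - 1 \<and> b = n - 1 then H $$ (a, b) else 0) + (if a \<in> R \<and> a = Suc b then 1 else 0)"
      using m12 by (simp add: sum.distrib)
    finally have F: "?F $$ (a, b) = (\<Sum>i=1..m. of_bool (a = b \<and> a \<in> S i))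
      + ((if a < n - 1 \<and> b = n - 1 then H $$ (a, b) else 0) + (if a \<in> R \<and> a = Suc b then 1 else 0))" .
    have Fc: "?F \<in> carrier_mat n n"
      by (rule finsum_mat_index(1)[OF _ _ ab]) (use E in auto)
    have "(?F + V) $$ (a, b) = ?F $$ (a, b) + of_bool (a = Suc b \<and> a \<notin> R)"
      using ab V by (simp add: V_def)
    also have "\<dots> = H $$ (a, b)"
    \<comment> \<open>In the last column the subdiagonal position lies outside the matrix, so
      neither \<open>R\<close> nor \<open>V\<close> contributes.\<close>
    proof (cases "b = n - 1")
      case True
      then show ?thesis using ab Hlast unfolding F by (cases "a = b") auto
    next
      case False
      then have "Suc b < n" using ab by auto
      then show ?thesis using ab False unfolding F Hent[OF ab(1) \<open>Suc b < n\<close>] by auto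
    qed
    finally show "H $$ (a, b) = (?F + V) $$ (a, b)" by simp
  qed (use H V in auto)
  ultimately show ?thesis using that E idem V by blast
qed

subsection \<open>Distribution of the ranks\<close>

text \<open>An amount \<open>x\<close> is poured greedily into \<open>M\<close> bins of capacity
  \<open>n\<close>.\<close>

lemma sum_min_diff: "(\<Sum>i<M. min n (x - i * n)) = min x (M * n)" for x n :: nat
  by (induction M) auto

lemma sum_first_two:
  fixes f :: "nat \<Rightarrow> nat"
  assumes "m \<ge> 2"
  shows "(\<Sum>i=1..m. f i) = f 1 + f 2 + (\<Sum>i<m - 2. f (i + 3))"
proof -
  have "(\<Sum>i=1..m. f i) = f 1 + f 2 + (\<Sum>i=3..m. f i)"
    using assms by (simp add: sum.atLeast_Suc_atMost numeral_2_eq_2 numeral_3_eq_3)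
  also have "(\<Sum>i=3..m. f i) = (\<Sum>i<m - 2. f (i + 3))"
    by (rule sum.reindex_bij_witness[of _ "\<lambda>i. i + 3" "\<lambda>i. i - 3"]) (use assms in auto)
  finally show ?thesis .
qed

text \<open>\<open>S 2\<close> contains \<open>R\<close> and avoids the predecessors
  \<open>R'\<close>, so its size ranges from \<open>card R\<close> to \<open>n - card R\<close>.
  Together with the \<open>m - 2\<close> free sets it absorbs any amount from \<open>card R\<close>
  to \<open>(m - 1) * n - card R\<close>; rank \<open>1\<close> or \<open>n - 1\<close> for
  \<open>S 1\<close> must leave a remainder in this interval.\<close>

lemma diagonal_sets_exist:
  fixes R :: "nat set"
  assumes "m \<ge> 2" "n > 0" and R: "R \<subseteq> {1..<n}" "\<And>b. Suc b \<in> R \<Longrightarrow> b \<notin> R"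
    and q: "2 * card R \<le> (m - 2) * n + 3"
    and T: "card R + 1 \<le> T" "T + card R + 1 \<le> m * n"
  obtains S :: "nat \<Rightarrow> nat set" where "\<And>i. S i \<subseteq> {..<n}" "S 1 = {..<n - 1} \<or> S 1 = {n - 1}"
    "R \<subseteq> S 2" "\<And>b. Suc b \<in> R \<Longrightarrow> b \<notin> S 2" "(\<Sum>i=1..m. card (S i)) = T"
proof -
  define R' where "R' = (\<lambda>r. r - 1) ` R"
  have fR: "finite R" using R(1) finite_subset by blast
  have "r \<ge> 1" if "r \<in> R" for r using R(1) that by auto
  then have "inj_on (\<lambda>r. r - 1) R" by (intro inj_onI) (metis le_add_diff_inverse)
  then have cR': "card R' = card R" unfolding R'_def by (rule card_image)
  have R': "R' \<subseteq> {..<n}" "R \<inter> R' = {}"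
  proof -
    show "R' \<subseteq> {..<n}" using R(1) by (force simp: R'_def)
    have "r - 1 \<notin> R" if "r \<in> R" for r using R(2)[of "r - 1"] R(1) that by force
    then show "R \<inter> R' = {}" by (auto simp: R'_def)
  qed
  have mn: "m * n = (m - 2) * n + 2 * n" using \<open>m \<ge> 2\<close> by (metis add_mult_distrib le_add_diff_inverse2)
  \<comment> \<open>Rank \<open>1\<close> is taken while the remainder stays below the upper end.
    Beyond that, removing \<open>n - 1\<close> still leaves at least \<open>card R\<close>, by the
    hypothesis \<open>q\<close>.\<close>
  define r1 where "r1 = (if T \<le> (m - 2) * n + n + 1 - card R then 1 else n - 1)"
  define S1 where "S1 = (if T \<le> (m - 2) * n + n + 1 - card R then {n - 1} else {..<n - 1})"
  have S1: "S1 = {..<n - 1} \<or> S1 = {n - 1}" "S1 \<subseteq> {..<n}" "card S1 = r1"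
    using \<open>n > 0\<close> by (auto simp: S1_def r1_def)
  define X where "X = T - r1"
  define s where "s = min X (n - card R)"
  \<comment> \<open>\<open>R\<close> and \<open>R'\<close> are disjoint and equally large, so
    \<open>R\<close> fills at most half of the positions.\<close>
  have "card (R \<union> R') = card R + card R'" by (rule card_Un_disjoint) (use R' fR in \<open>auto simp: R'_def\<close>)
  moreover have "card (R \<union> R') \<le> card {..<n}" by (rule card_mono) (use R R' in auto)
  ultimately have twice: "2 * card R \<le> n" using cR' by simp
  have X: "r1 \<le> T" "card R \<le> X" "X + card R \<le> n + (m - 2) * n"
    using T q twice \<open>n > 0\<close> unfolding mn X_def r1_def by (auto split: if_splits)
  have s: "card R \<le> s" "s \<le> n - card R" "s \<le> X" "X - s \<le> (m - 2) * n"
    using X twice by (auto simp: s_def)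
  have "\<exists>S2. R \<subseteq> S2 \<and> S2 \<subseteq> {..<n} - R' \<and> card S2 = s"
    by (rule exists_subset_between) (use s R R' cR' in \<open>auto simp: card_Diff_subset finite_subset\<close>)
  then obtain S2 where S2: "R \<subseteq> S2" "S2 \<subseteq> {..<n} - R'" "card S2 = s" by blast
  define S where "S = (\<lambda>i::nat. if i = 1 then S1 else if i = 2 then S2 else {..<min n (X - s - (i - 3) * n)})"
  have "(\<Sum>i<m - 2. card (S (i + 3))) = (\<Sum>i<m - 2. min n (X - s - i * n))"
    by (intro sum.cong refl) (simp add: S_def)
  also have "\<dots> = X - s" unfolding sum_min_diff using s(4) by simp
  finally have "(\<Sum>i=1..m. card (S i)) = r1 + s + (X - s)"
    unfolding sum_first_two[OF \<open>m \<ge> 2\<close>] by (simp add: S_def S1 S2)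
  also have "\<dots> = T" using s(3) X(1) by (simp add: X_def)
  finally have sumT: "(\<Sum>i=1..m. card (S i)) = T" .
  have sub: "S i \<subseteq> {..<n}" for i using S1(2) S2(2) by (auto simp: S_def)
  have "b \<notin> S 2" if "Suc b \<in> R" for b using S2(2) that by (force simp: S_def R'_def)
  moreover have "R \<subseteq> S 2" "S 1 = {..<n - 1} \<or> S 1 = {n - 1}" using S1(1) S2(1) by (auto simp: S_def)
  ultimately show ?thesis using that sub sumT by blast
qed

text \<open>Row \<open>0\<close> is excluded because it has no subdiagonal entry. As
  \<open>k >= 2\<close>, cut rows are never adjacent, which the second idempotent requires.\<close>

lemma cut_rows:
  fixes k n :: nat
  assumes "k \<ge> 2"
  defines "R \<equiv> {r. 0 < r \<and> r < n \<and> k dvd n - r}"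
  shows "R \<subseteq> {1..<n}" "Suc b \<in> R \<Longrightarrow> b \<notin> R" "b + k < n \<Longrightarrow> \<exists>r\<in>R. b < r \<and> r \<le> b + k"
    "card R * k \<le> n - 1"
proof -
  show sub: "R \<subseteq> {1..<n}" by (auto simp: R_def)
  show "b \<notin> R" if "Suc b \<in> R"
  proof
    assume "b \<in> R"
    then have "k dvd n - b" "k dvd n - Suc b" "Suc b < n" using that by (auto simp: R_def)
    then have "k dvd (n - b) - (n - Suc b)" by (metis dvd_diff_nat)
    moreover have "(n - b) - (n - Suc b) = 1" using \<open>Suc b < n\<close> by simp
    ultimately show False using \<open>k \<ge> 2\<close> by simp
  qed
  show "\<exists>r\<in>R. b < r \<and> r \<le> b + k" if "b + k < n"
  proof -
    \<comment> \<open>The largest multiple of \<open>k\<close> not exceeding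
      \<open>n - b - 1\<close>; then \<open>n - y\<close> is the first cut row after
      \<open>b\<close>.\<close>
    define y where "y = k * ((n - b - 1) div k)"
    have "(n - b - 1) mod k < k" using \<open>k \<ge> 2\<close> by simp
    moreover have "y + (n - b - 1) mod k = n - b - 1" unfolding y_def by (simp add: mult.commute)
    moreover have "(n - b - 1) div k \<ge> 1" using that \<open>k \<ge> 2\<close> by (simp add: div_greater_zero_iff Suc_le_eq)
    then have "y \<ge> k" unfolding y_def by simp
    ultimately have y: "b < n - y" "n - y \<le> b + k" "n - y < n" "n - (n - y) = y"
      using that \<open>k \<ge> 2\<close> by linarith+
    have "k dvd y" by (simp add: y_def)
    then have "n - y \<in> R" "b < n - y" "n - y \<le> b + k" using y by (auto simp: R_def)
    then show ?thesis by blast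
  qed
  have "inj_on (\<lambda>r. (n - r) div k) R"
  proof (rule inj_onI)
    fix r r' assume "r \<in> R" "r' \<in> R" "(n - r) div k = (n - r') div k"
    then have "n - r = n - r'" "r < n" "r' < n" by (auto simp: R_def) (metis dvd_div_eq_iff)
    then show "r = r'" by simp
  qed
  moreover have "(\<lambda>r. (n - r) div k) ` R \<subseteq> {1..(n - 1) div k}"
    using \<open>k \<ge> 2\<close> by (auto simp: R_def Suc_le_eq div_greater_zero_iff dvd_imp_le intro!: div_le_mono)
  ultimately have "card R \<le> card {1..(n - 1) div k}" by (rule card_inj_on_le) simp
  then have "card R \<le> (n - 1) div k" by simp
  then have "card R * k \<le> (n - 1) div k * k" by (rule mult_le_mono1)
  also have "\<dots> \<le> n - 1" by (rule div_times_less_eq_dividend)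
  finally show "card R * k \<le> n - 1" .
qed

text \<open>The choice of \<open>k\<close> yields \<open>m * k >= p + m - 1\<close>. If
  \<open>q > 0\<close>, then \<open>n >= k + 2 * (q - 1) + 1\<close>, and multiplying by
  \<open>m\<close> gives the first bound.\<close>

lemma cut_count_bounds:
  fixes m n p q k :: nat
  assumes "m \<ge> 2" "m * n - 1 \<ge> p" "p \<ge> n" "p \<ge> 3" and k: "k = (p - 2) div m + 2" and q: "q * k \<le> n - 1"
  shows "2 * q + 1 + p \<le> m * n" "2 * q \<le> (m - 2) * n + 3"
proof -
  have "m * ((p - 2) div m) + (p - 2) mod m = p - 2" "(p - 2) mod m < m" using \<open>m \<ge> 2\<close> by auto
  moreover have "m * k = m * ((p - 2) div m) + 2 * m" unfolding k by (simp add: algebra_simps)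
  ultimately have mk: "p + m \<le> m * k + 1" using \<open>p \<ge> 3\<close> by linarith
  have k2: "k \<ge> 2" unfolding k by simp
  show "2 * q + 1 + p \<le> m * n"
  proof (cases q)
    case 0
    then show ?thesis using assms by simp
  next
    case (Suc q')
    have "k + q' * k \<le> n - 1" using q unfolding Suc by simp
    then have "k + 2 * q' + 1 \<le> n" using k2 mult_le_mono2[OF k2, of q'] by linarith
    then have "m * (k + (2 * q' + 1)) \<le> m * n" by (intro mult_le_mono2) simp
    then have "m * k + m * (2 * q' + 1) \<le> m * n" by (simp only: add_mult_distrib2)
    moreover have "2 * (2 * q' + 1) \<le> m * (2 * q' + 1)" using \<open>m \<ge> 2\<close> by (rule mult_le_mono1)
    then have "4 * q' + 2 \<le> m * (2 * q' + 1)" by simp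
    ultimately have "m * k + (4 * q' + 2) \<le> m * n" by (meson add_left_mono order.trans)
    \<comment> \<open>\<open>x\<close> and \<open>y\<close> stand for \<open>m * k\<close> and
      \<open>m * n\<close>, which keeps the arithmetic linear.\<close>
    moreover have "2 * q + 1 + p \<le> y" if "x + (4 * q' + 2) \<le> y" "p + m \<le> x + 1" for x y
      using that \<open>m \<ge> 2\<close> unfolding Suc by simp
    ultimately show ?thesis using mk by blast
  qed
  show "2 * q \<le> (m - 2) * n + 3"
  proof (cases "m = 2")
    case True
    \<comment> \<open>For \<open>m = 2\<close>, \<open>2 * k >= p + 1 > n - 1\<close>, so two cuts
      do not fit.\<close>
    have "q \<le> 1"
    proof (rule ccontr)
      assume "\<not> q \<le> 1"
      then have "2 * k \<le> q * k" by (intro mult_le_mono1) simp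
      then show False using mk q \<open>p \<ge> n\<close> \<open>p \<ge> 3\<close> unfolding True by linarith
    qed
    then show ?thesis by simp
  next
    case False
    then have "1 * n \<le> (m - 2) * n" using \<open>m \<ge> 2\<close> by (intro mult_le_mono1) simp
    moreover have "q * 2 \<le> q * k" using k2 by (rule mult_le_mono2)
    ultimately show ?thesis using q by linarith
  qed
qed

subsection \<open>The decomposition\<close>

text \<open>Conjugation by \<open>P\<close> respects sums and products, so a decomposition of
  \<open>H\<close> carries over to the original matrix.\<close>

lemma decomposition_conjugate:
  fixes H :: "'a :: comm_ring_1 mat"
  assumes carr: "H \<in> carrier_mat n n" "P \<in> carrier_mat n n" "Q \<in> carrier_mat n n"
    and PQ: "P * Q = 1\<^sub>m n" "Q * P = 1\<^sub>m n"
    and E: "\<And>i. E i \<in> carrier_mat n n" "\<And>i. idempotent_mat (E i)"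
    and V: "V \<in> carrier_mat n n" "V ^\<^sub>m k = 0\<^sub>m n n"
    and HE: "H = (\<Oplus>\<^bsub>ring_mat TYPE('a) n ()\<^esub>i\<in>I. E i) + V" and "finite I"
  shows "idempotent_mat (P * E i * Q)" "(P * V * Q) ^\<^sub>m k = 0\<^sub>m n n"
    "P * H * Q = (\<Oplus>\<^bsub>ring_mat TYPE('a) n ()\<^esub>i\<in>I. P * E i * Q) + P * V * Q"
proof -
  let ?R = "ring_mat TYPE('a) n ()"
  interpret R: ring ?R by (rule ring_mat)
  note sm = ring_mat_simps
  have EE: "E i * E i = E i" using E(2) by (simp add: idempotent_mat_def)
  have assoc: "X * Y * Z = X * (Y * Z)"
    if "X \<in> carrier_mat n n" "Y \<in> carrier_mat n n" "Z \<in> carrier_mat n n" for X Y Z :: "'a mat"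
    using that by (rule assoc_mult_mat)
  have mc: "X * Y \<in> carrier_mat n n"
    if "X \<in> carrier_mat n n" "Y \<in> carrier_mat n n" for X Y :: "'a mat"
    using that by (rule mult_carrier_mat)
  have "(P * E i * Q) * (P * E i * Q) = P * (E i * ((Q * P) * (E i * Q)))"
    by (simp only: assoc mc carr E)
  also have "\<dots> = P * ((E i * E i) * Q)"
    unfolding PQ left_mult_one_mat[OF mc[OF E(1) carr(3)]] by (simp only: assoc mc carr E)
  also have "\<dots> = P * E i * Q" unfolding EE by (simp only: assoc mc carr E)
  finally show "idempotent_mat (P * E i * Q)"
    using carr E(1)[of i] by (simp add: idempotent_mat_def)
  have "similar_mat_wit (P * V * Q) V P Q"
    using carr V PQ by (simp add: similar_mat_wit_def Let_def)
  then show "(P * V * Q) ^\<^sub>m k = 0\<^sub>m n n"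
    using carr V(2) by (simp add: similar_mat_wit_pow_id)
  have F: "(\<Oplus>\<^bsub>?R\<^esub>i\<in>I. E i) \<in> carrier_mat n n"
    using R.finsum_closed[of E I] E(1) by (simp add: sm Pi_def)
  have "(\<Oplus>\<^bsub>?R\<^esub>i\<in>I. P * E i * Q) = (\<Oplus>\<^bsub>?R\<^esub>i\<in>I. P * E i) * Q"
    using R.finsum_ldistr[OF \<open>finite I\<close>, of Q "\<lambda>i. P * E i"] carr E(1) mc by (simp add: sm Pi_def)
  also have "(\<Oplus>\<^bsub>?R\<^esub>i\<in>I. P * E i) = P * (\<Oplus>\<^bsub>?R\<^esub>i\<in>I. E i)"
    using R.finsum_rdistr[OF \<open>finite I\<close>, of P E] carr E(1) by (simp add: sm Pi_def)
  finally have S: "(\<Oplus>\<^bsub>?R\<^esub>i\<in>I. P * E i * Q) = P * (\<Oplus>\<^bsub>?R\<^esub>i\<in>I. E i) * Q" .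
  show "P * H * Q = (\<Oplus>\<^bsub>?R\<^esub>i\<in>I. P * E i * Q) + P * V * Q"
    unfolding S HE mult_add_distrib_mat[OF carr(2) F V(1)]
    by (rule add_mult_distrib_mat[OF mc[OF carr(2) F] mc[OF carr(2) V(1)] carr(3)])
qed

theorem theorem7:
  fixes A :: "'a :: field mat" and p m n t :: nat
  assumes "CHAR('a) = p" and "odd p"
    and "m \<ge> 2" and "n > 0"
    and "m * n - 1 \<ge> p" and "p \<ge> n"
    and "A \<in> carrier_mat n n" and "nonderogatory A"
    and "t \<in> {0..p - 1}" and "mat_trace A = of_nat t"
  shows "\<exists>(E :: nat \<Rightarrow> 'a mat) V.
           (\<forall>i\<in>{1..m}. E i \<in> carrier_mat n n \<and> idempotent_mat (E i)) \<and>
           V \<in> carrier_mat n n \<and> nilpotent_mat V \<and>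
           A = (\<Oplus>\<^bsub>ring_mat TYPE('a) n ()\<^esub>i\<in>{1..m}. E i) + V \<and>
           V ^\<^sub>m ((p - 2) div m + 2) = 0\<^sub>m n n"
proof -
  define k where "k = (p - 2) div m + 2"
  have p0: "(of_nat p :: 'a) = 0" using of_nat_CHAR assms(1) by metis
  obtain j where j: "p = 2 * j + 1" using \<open>odd p\<close> by (rule oddE)
  \<comment> \<open>Otherwise \<open>p = 1\<close>, and \<open>1 = 0\<close> would hold in the
    field.\<close>
  have "j \<noteq> 0" using p0 unfolding j by (cases j) auto
  then have p3: "p \<ge> 3" unfolding j by simp
  have k2: "k \<ge> 2" by (simp add: k_def)
  define R where "R = {r. 0 < r \<and> r < n \<and> k dvd n - r}"
  note R = cut_rows[OF k2, where n = n, folded R_def]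
  define q where "q = card R"
  note q = cut_count_bounds[OF assms(3,5,6) p3 k_def R(4), folded q_def]
  have "q \<le> q * k" using k2 by simp
  then have qn: "q + 1 \<le> n" using R(4) \<open>n > 0\<close> unfolding q_def by linarith
  \<comment> \<open>\<open>t\<close> and \<open>p + t\<close> agree in the field. If
    \<open>t\<close> is too small to cover the cuts, \<open>p + t\<close> is large enough because
    \<open>q + 1 <= n <= p\<close>, and it stays below the upper limit by
    \<open>q(1)\<close>.\<close>
  define T where "T = (if t \<le> q then p + t else t)"
  have T: "card R + 1 \<le> T" "T + card R + 1 \<le> m * n"
    using q(1) qn assms(5,6,9) p3 unfolding T_def q_def by auto
  have tT: "of_nat T = (of_nat t :: 'a)" unfolding T_def using p0 by simp
  obtain S :: "nat \<Rightarrow> nat set" where S: "\<And>i. S i \<subseteq> {..<n}" "S 1 = {..<n - 1} \<or> S 1 = {n - 1}"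
      "R \<subseteq> S 2" "\<And>b. Suc b \<in> R \<Longrightarrow> b \<notin> S 2" "(\<Sum>i=1..m. card (S i)) = T"
    using diagonal_sets_exist[OF assms(3,4) R(1,2) q(2)[unfolded q_def] T] by metis
  define d :: "nat \<Rightarrow> 'a" where "d = (\<lambda>b. \<Sum>i=1..m. of_bool (b \<in> S i))"
  obtain H P Q where H: "H \<in> carrier_mat n n" and P: "P \<in> carrier_mat n n" and Q: "Q \<in> carrier_mat n n"
    and PQ: "P * Q = 1\<^sub>m n" "Q * P = 1\<^sub>m n" and AH: "A = P * H * Q"
    and Hent: "\<And>a b. a < n \<Longrightarrow> Suc b < n \<Longrightarrow> H $$ (a, b) = (if a = b then d b else if a = Suc b then 1 else 0)"
    using nonderogatory_hessenberg_form[OF assms(7,8), of d] by metis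
  have "mat_trace A = mat_trace (Q * (P * H))"
    unfolding AH by (rule mat_trace_mult_comm[OF mult_carrier_mat[OF P H] Q])
  also have "Q * (P * H) = H" using assoc_mult_mat[OF Q P H] PQ(2) H by simp
  finally have trH: "mat_trace H = of_nat t" using assms(10) by simp
  have "(\<Sum>b<n. d b) = (\<Sum>i=1..m. \<Sum>b<n. of_bool (b \<in> S i))" unfolding d_def by (rule sum.swap)
  also have "\<dots> = (\<Sum>i=1..m. of_nat (card (S i)))"
  proof (rule sum.cong[OF refl])
    fix i
    have "(\<Sum>b<n. of_bool (b \<in> S i)) = (\<Sum>b\<in>S i. 1 :: 'a)"
      using S(1)[of i] by (intro sum.mono_neutral_cong_right) auto
    then show "(\<Sum>b<n. of_bool (b \<in> S i)) = (of_nat (card (S i)) :: 'a)" by simp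
  qed
  also have "\<dots> = of_nat t" using S(5) tT by (metis of_nat_sum)
  finally have "(\<Sum>b<n. d b) = mat_trace H" using trH by simp
  moreover have n: "{..<n} = insert (n - 1) {..<n - 1}" using \<open>n > 0\<close> by auto
  moreover have "(\<Sum>b<n - 1. H $$ (b, b)) = (\<Sum>b<n - 1. d b)" by (intro sum.cong refl) (simp add: Hent)
  \<comment> \<open>The traces agree, and so do the first \<open>n - 1\<close> diagonal entries; the
    last one is therefore forced.\<close>
  ultimately have Hlast: "H $$ (n - 1, n - 1) = d (n - 1)"
    using H unfolding mat_trace_def by simp
  obtain E V where E: "\<And>i. E i \<in> carrier_mat n n" "\<And>i. idempotent_mat (E i)" and V: "V \<in> carrier_mat n n"
    and HE: "H = (\<Oplus>\<^bsub>ring_mat TYPE('a) n ()\<^esub>i\<in>{1..m}. E i) + V" and Vk: "V ^\<^sub>m k = 0\<^sub>m n n"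
    using hessenberg_idempotents_nilpotent[OF H assms(3) Hent[unfolded d_def] Hlast[unfolded d_def] S(2,3,4) R(3)]
    by metis
  note c = decomposition_conjugate[OF H P Q PQ E V Vk HE finite_atLeastAtMost]
  have "P * V * Q \<in> carrier_mat n n" using P V Q by simp
  moreover have "nilpotent_mat (P * V * Q)" unfolding nilpotent_mat_def using c(2) P Q by auto
  moreover have "P * E i * Q \<in> carrier_mat n n" for i using P E(1)[of i] Q by simp
  ultimately show ?thesis using c AH unfolding k_def by (intro exI[of _ "\<lambda>i. P * E i * Q"] exI[of _ "P * V * Q"]) auto
qed

end
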